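(* Let $n\ge 1$ be an integer. Suppose that for all vectors $a_1,\ldots,a_n\in\mathbb{C}^n$ satisfying $\|a_i\|_\infty\le 1$ for every $i=1,\ldots,n$ there exists a vector $x\in\mathbb{C}^n$ with all coordinates of modulus $1$ such that $|\langle x,a_i\rangle|\le\sqrt{n}$ for every $i=1,\ldots,n$. Then $$d_{BM}(\ell_1^n(\mathbb{C}),\ell_\infty^n(\mathbb{C}))=\sqrt{n}.$$
   Context: $\ell_1^n(\mathbb{C})$ is $\mathbb{C}^n$ with the norm $\|x\|_1=|x_1|+\cdots+|x_n|$, and $\ell_\infty^n(\mathbb{C})$ is $\mathbb{C}^n$ with the norm $\|x\|_\infty=\max_i|x_i|$. The inner product on $\mathbb{C}^n$ is $\langle x,y\rangle=x_1\overline{y_1}+\cdots+x_n\overline{y_n}$. For two normed spaces $X,Y$ over $\mathbb{C}$ of the same finite dimension, the Banach--Mazur distance is $d_{BM}(X,Y)=\inf\|A\|_{X\to Y}\cdot\|A^{-1}\|_{Y\to X}$, where the infimum is over all invertible ($\mathbb{C}$-)linear operators $A:X\to Y$ and $\|\cdot\|_{X\to Y}$ denotes the operator norm. *)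

theory Defs
  imports "HOL-Analysis.Analysis"
begin

definition cinner :: "complex ^ 'n \<Rightarrow> complex ^ 'n \<Rightarrow> complex" where
  "cinner x y = (\<Sum>i\<in>UNIV. x $ i * cnj (y $ i))"

definition l1_norm :: "complex ^ 'n \<Rightarrow> real" where
  "l1_norm x = (\<Sum>i\<in>UNIV. cmod (x $ i))"

(* The library constant infnorm is not suitable here: on complex ^ 'n it takes the maximum
   over the real and imaginary parts of the coordinates. *)
definition linf_norm :: "complex ^ 'n \<Rightarrow> real" where
  "linf_norm x = Max (range (\<lambda>i. cmod (x $ i)))"

(* The library constant onorm, with the norms of domain and codomain as explicit arguments.
   As there, x = 0 contributes 0 / 0 = 0. The supremum is finite for the linear maps between
   finite-dimensional normed spaces to which it is applied. *)
definition op_norm :: "('a \<Rightarrow> real) \<Rightarrow> ('b \<Rightarrow> real) \<Rightarrow> ('a \<Rightarrow> 'b) \<Rightarrow> real" where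
  "op_norm NX NY f = (SUP x. NY (f x) / NX x)"

(* A complex normed space is given by the scalar multiplication and the norm on its type.
   The infimum is over a nonempty set, bounded below by 0, when the dimensions are finite
   and equal. *)
definition banach_mazur_dist ::
  "(complex \<Rightarrow> 'a::ab_group_add \<Rightarrow> 'a) \<Rightarrow> ('a \<Rightarrow> real) \<Rightarrow>
   (complex \<Rightarrow> 'b::ab_group_add \<Rightarrow> 'b) \<Rightarrow> ('b \<Rightarrow> real) \<Rightarrow> real" where
  "banach_mazur_dist sX NX sY NY =
     Inf {op_norm NX NY A * op_norm NY NX (inv A) | A. Vector_Spaces.linear sX sY A \<and> bij A}"

end

theory Submission
  imports Defs
begin

text \<open>
  Lower bound: after scaling, the rows of the matrix of \<open>A\<close> have sup norm at most 1, so the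
  hypothesis gives a unimodular \<open>x\<close>, of \<open>\<ell>\<^sub>1\<close> norm \<open>n\<close>, that \<open>A\<close> maps to a vector of sup norm at most
  \<open>\<parallel>A\<parallel> \<surd>n\<close>; hence \<open>\<parallel>A\<^sup>-\<^sup>1\<parallel> \<ge> \<surd>n / \<parallel>A\<parallel>\<close>. Upper bound: the discrete Fourier matrix has unimodular
  entries and multiplies the Euclidean norm by \<open>\<surd>n\<close>.
\<close>

section \<open>Basic facts on the two norms\<close>

lemma cmod_le_linf_norm: "cmod (x $ i) \<le> linf_norm (x :: complex ^ 'n::finite)"
  unfolding linf_norm_def by (rule Max_ge) auto

lemma linf_norm_leI:
  assumes "\<And>i. cmod (x $ i) \<le> C"
  shows "linf_norm (x :: complex ^ 'n::finite) \<le> C"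
  unfolding linf_norm_def using assms by (subst Max_le_iff) auto

lemma linf_norm_nonneg: "0 \<le> linf_norm (x :: complex ^ 'n::finite)"
  using cmod_le_linf_norm[of x undefined] norm_ge_zero order_trans by blast

lemma linf_norm_pos:
  assumes "x \<noteq> 0"
  shows "0 < linf_norm (x :: complex ^ 'n::finite)"
proof -
  obtain i where "x $ i \<noteq> 0"
    using assms by (auto simp: vec_eq_iff)
  then have "0 < cmod (x $ i)" by simp
  then show ?thesis
    using cmod_le_linf_norm[of x i] by linarith
qed

lemma l1_norm_nonneg: "0 \<le> l1_norm x"
  unfolding l1_norm_def by (simp add: sum_nonneg)

lemma linf_norm_le_l1_norm: "linf_norm x \<le> l1_norm (x :: complex ^ 'n::finite)"
  unfolding l1_norm_def by (rule linf_norm_leI) (auto intro: member_le_sum)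

lemma l1_norm_axis: "l1_norm (axis j 1 :: complex ^ 'n::finite) = 1"
proof -
  have "l1_norm (axis j 1 :: complex ^ 'n) = (\<Sum>i\<in>UNIV. if i = j then 1 else 0)"
    unfolding l1_norm_def axis_def by (intro sum.cong) auto
  then show ?thesis by simp
qed

section \<open>Bounded linear maps and operator norms\<close>

lemma linear_component_eq_sum:
  assumes "Vector_Spaces.linear (*s) (*s) (A :: complex ^ 'n::finite \<Rightarrow> complex ^ 'n)"
  shows "A x $ i = (\<Sum>j\<in>UNIV. A (axis j 1) $ i * x $ j)"
proof -
  have "A x = matrix A *v x"
    using matrix_works[OF assms] by metis
  then show ?thesis
    by (simp add: matrix_vector_mult_def matrix_def)
qed

text \<open>The sum of the moduli of all matrix entries serves as \<open>K\<close>. Since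
  \<open>linf_norm\<close> is at most \<open>l1_norm\<close>, this one estimate bounds linear maps
  in both directions between the two spaces.\<close>

lemma linear_l1_norm_le_linf_norm:
  assumes "Vector_Spaces.linear (*s) (*s) (A :: complex ^ 'n::finite \<Rightarrow> complex ^ 'n)"
  obtains K where "0 \<le> K" "\<And>x. l1_norm (A x) \<le> K * linf_norm x"
proof
  let ?K = "\<Sum>i\<in>UNIV. \<Sum>j\<in>UNIV. cmod (A (axis j 1) $ i)"
  show "0 \<le> ?K" by (intro sum_nonneg) auto
  fix x
  have "cmod (A x $ i) \<le> (\<Sum>j\<in>UNIV. cmod (A (axis j 1) $ i) * linf_norm x)" for i
    unfolding linear_component_eq_sum[OF assms, of x i]
    by (rule order_trans[OF norm_sum])
       (auto intro!: sum_mono mult_left_mono cmod_le_linf_norm simp: norm_mult)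
  then show "l1_norm (A x) \<le> ?K * linf_norm x"
    unfolding l1_norm_def by (auto simp: sum_distrib_right intro!: sum_mono)
qed

text \<open>The assumption \<open>0 \<le> C\<close> covers the points with \<open>NX x = 0\<close>,
  where the quotient is 0 by the convention for division.\<close>

lemma op_norm_leI:
  assumes "\<And>x. NY (f x) \<le> C * NX x" "\<And>x. 0 \<le> NX x" "0 \<le> C"
  shows "op_norm NX NY f \<le> C"
  unfolding op_norm_def
proof (rule cSUP_least)
  fix x
  show "NY (f x) / NX x \<le> C"
  proof (cases "NX x = 0")
    case False
    then have "0 < NX x" using assms(2)[of x] by linarith
    then show ?thesis using assms(1)[of x] by (simp add: pos_divide_le_eq)
  qed (simp add: assms)
qed simp

text \<open>The constant \<open>C\<close> only witnesses that the quotients are bounded above, so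
  that the real supremum is a genuine upper bound.\<close>

lemma quotient_le_op_norm:
  assumes "\<And>x. NY (f x) \<le> C * NX x" "\<And>x. 0 \<le> NX x" "0 \<le> C"
  shows "NY (f x) / NX x \<le> op_norm NX NY f"
  unfolding op_norm_def
proof (rule cSUP_upper)
  show "bdd_above (range (\<lambda>x. NY (f x) / NX x))"
  proof (rule bdd_aboveI2)
    fix x
    show "NY (f x) / NX x \<le> C"
    proof (cases "NX x = 0")
      case False
      then have "0 < NX x" using assms(2)[of x] by linarith
      then show ?thesis using assms(1)[of x] by (simp add: pos_divide_le_eq)
    qed (simp add: assms)
  qed
qed simp

lemma quotient_le_op_norm_l1_linf:
  assumes "Vector_Spaces.linear (*s) (*s) (A :: complex ^ 'n::finite \<Rightarrow> complex ^ 'n)"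
  shows "linf_norm (A x) / l1_norm x \<le> op_norm l1_norm linf_norm A"
proof -
  obtain K where K: "0 \<le> K" "\<And>x. l1_norm (A x) \<le> K * linf_norm x"
    using linear_l1_norm_le_linf_norm[OF assms] by blast
  have "linf_norm (A x) \<le> K * l1_norm x" for x
    using linf_norm_le_l1_norm[of "A x"] K(2)[of x]
      mult_left_mono[OF linf_norm_le_l1_norm[of x] K(1)] by linarith
  then show ?thesis
    by (rule quotient_le_op_norm) (simp_all add: K l1_norm_nonneg)
qed

lemma quotient_le_op_norm_linf_l1:
  assumes "Vector_Spaces.linear (*s) (*s) (A :: complex ^ 'n::finite \<Rightarrow> complex ^ 'n)"
  shows "l1_norm (A x) / linf_norm x \<le> op_norm linf_norm l1_norm A"
  using linear_l1_norm_le_linf_norm[OF assms]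
  by (metis quotient_le_op_norm linf_norm_nonneg)

section \<open>Lower bound for the distance\<close>

lemma linear_inv_vec:
  assumes "Vector_Spaces.linear (*s) (*s) (A :: complex ^ 'n::finite \<Rightarrow> complex ^ 'n)" "bij A"
  shows "Vector_Spaces.linear (*s) (*s) (inv A)"
proof -
  interpret A: Vector_Spaces.linear "(*s)" "(*s)" A by fact
  have *: "A (inv A y) = y" "inv A (A y) = y" for y
    using \<open>bij A\<close> by (simp_all add: bij_is_surj surj_f_inv_f bij_is_inj)
  show ?thesis
    by unfold_locales (metis * A.add, metis * A.scale)
qed

lemma sqrt_card_le_op_norm_mult:
  fixes A :: "complex ^ 'n::finite \<Rightarrow> complex ^ 'n"
  assumes signs: "\<And>a :: 'n \<Rightarrow> complex ^ 'n.
      (\<forall>i. linf_norm (a i) \<le> 1) \<Longrightarrow>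
      \<exists>x :: complex ^ 'n. (\<forall>j. cmod (x $ j) = 1) \<and>
        (\<forall>i. cmod (cinner x (a i)) \<le> sqrt (real CARD('n)))"
  assumes lin: "Vector_Spaces.linear (*s) (*s) A" and bij: "bij A"
  shows "sqrt (real CARD('n)) \<le> op_norm l1_norm linf_norm A * op_norm linf_norm l1_norm (inv A)"
proof -
  interpret A: Vector_Spaces.linear "(*s)" "(*s)" A by fact
  define \<alpha> where "\<alpha> = op_norm l1_norm linf_norm A"
  define \<beta> where "\<beta> = op_norm linf_norm l1_norm (inv A)"
  let ?n = "real CARD('n)"
  have nz: "A x \<noteq> 0" if "x \<noteq> 0" for x
    using that bij A.zero by (metis bij_is_inj injD)
  \<comment> \<open>Unit vectors have \<open>l1_norm\<close> 1, so every matrix entry of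
    \<open>A\<close> has modulus at most \<alpha>.\<close>
  have axis_le: "linf_norm (A (axis j 1)) \<le> \<alpha>" for j
    using quotient_le_op_norm_l1_linf[OF lin, of "axis j 1"]
    by (simp add: l1_norm_axis \<alpha>_def)
  \<comment> \<open>Any single nonzero column shows that \<alpha> may be divided by;
    \<open>undefined\<close> is just some index.\<close>
  have "0 < linf_norm (A (axis undefined 1))"
    by (intro linf_norm_pos nz) (simp add: axis_eq_0_iff)
  with axis_le[of undefined] have \<alpha>: "0 < \<alpha>" by linarith
  \<comment> \<open>The scaled rows of the matrix, conjugated because \<open>cinner\<close>
    conjugates its second argument: thus \<open>cinner x (a i)\<close> is \<open>A x $ i\<close>
    divided by \<alpha>.\<close>
  define a :: "'n \<Rightarrow> complex ^ 'n"
    where "a i = (\<chi> j. cnj (A (axis j 1) $ i) / of_real \<alpha>)" for i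
  have "linf_norm (a i) \<le> 1" for i
  proof (rule linf_norm_leI)
    fix j
    have "cmod (A (axis j 1) $ i) \<le> \<alpha>"
      using cmod_le_linf_norm axis_le order_trans by blast
    then show "cmod (a i $ j) \<le> 1"
      using \<alpha> by (simp add: a_def norm_divide)
  qed
  then obtain x :: "complex ^ 'n" where x: "\<And>j. cmod (x $ j) = 1"
    "\<And>i. cmod (cinner x (a i)) \<le> sqrt ?n"
    using signs by blast
  have "cinner x (a i) = A x $ i / of_real \<alpha>" for i
    unfolding linear_component_eq_sum[OF lin, of x i] cinner_def a_def
    by (simp add: sum_divide_distrib mult.commute)
  then have Ax: "linf_norm (A x) \<le> sqrt ?n * \<alpha>"
    using x(2) \<alpha> by (intro linf_norm_leI) (simp add: norm_divide pos_divide_le_eq)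
  have "x \<noteq> 0" using x(1) by (metis norm_zero zero_index zero_neq_one)
  then have pos: "0 < linf_norm (A x)" by (intro linf_norm_pos nz)
  have l1: "l1_norm (inv A (A x)) = ?n"
    using bij x(1) by (simp add: bij_is_inj l1_norm_def)
  \<comment> \<open>The norm of \<open>inv A\<close> is tested at the single vector
    \<open>A x\<close>.\<close>
  have "?n / linf_norm (A x) \<le> \<beta>"
    using quotient_le_op_norm_linf_l1[OF linear_inv_vec[OF lin bij], of "A x"]
    unfolding l1 \<beta>_def .
  moreover have "0 \<le> ?n / linf_norm (A x)"
    using pos by simp
  ultimately have "?n \<le> \<beta> * linf_norm (A x)" and "0 \<le> \<beta>"
    using pos by (simp add: pos_divide_le_eq, linarith)
  then have "?n \<le> \<beta> * (sqrt ?n * \<alpha>)"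
    using mult_left_mono[OF Ax, of \<beta>] by linarith
  then have "sqrt ?n * sqrt ?n \<le> sqrt ?n * (\<alpha> * \<beta>)"
    by (simp add: mult_ac)
  then show ?thesis
    unfolding \<alpha>_def \<beta>_def by (rule mult_left_le_imp_le) simp
qed

section \<open>The discrete Fourier matrix\<close>

text \<open>The terms are the powers of an \<open>n\<close>-th root of unity \<open>z\<close>, which
  is 1 only for \<open>p = q\<close>; otherwise the geometric sum vanishes.\<close>

lemma sum_root_of_unity_orthogonal:
  fixes n p q :: nat
  assumes "p < n" "q < n"
  defines "\<omega> \<equiv> cis (2 * pi / real n)"
  shows "(\<Sum>k<n. \<omega> ^ (k * p) * cnj (\<omega> ^ (k * q))) = (if p = q then of_nat n else 0)"
proof -
  have n: "n > 0" using assms by simp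
  \<comment> \<open>This is \<omega> to the power \<open>p - q\<close>; the conjugate stands for the
    inverse and avoids truncated subtraction.\<close>
  define z where "z = \<omega> ^ p * cnj (\<omega> ^ q)"
  have unit: "\<omega> ^ m * cnj (\<omega> ^ m) = 1" for m
    by (simp add: \<omega>_def Complex.DeMoivre cis_cnj cis_mult)
  have "\<omega> ^ n = 1"
    using n by (simp add: \<omega>_def Complex.DeMoivre)
  then have zn: "z ^ n = 1"
    unfolding z_def by (metis complex_cnj_one complex_cnj_power mult.commute mult_1
        power_mult power_mult_distrib power_one)
  have sum_eq: "(\<Sum>k<n. \<omega> ^ (k * p) * cnj (\<omega> ^ (k * q))) = (\<Sum>k<n. z ^ k)"
    by (intro sum.cong) (simp_all add: z_def power_mult_distrib mult.commute[of _ p]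
        mult.commute[of _ q] power_mult)
  show ?thesis
  proof (cases "p = q")
    case True
    then have "z = 1" using unit by (simp add: z_def)
    with sum_eq True show ?thesis by simp
  next
    case False
    have "z \<noteq> 1"
    proof
      assume "z = 1"
      then have "\<omega> ^ p = \<omega> ^ q"
        using unit[of q] by (metis z_def mult.assoc mult.commute mult.right_neutral)
      moreover have "\<omega> ^ m = exp (2 * of_real pi * \<i> * of_nat m / of_nat n)" for m
        unfolding \<omega>_def Complex.DeMoivre by (simp add: cis_conv_exp mult_ac)
      ultimately have "p mod n = q mod n"
        using complex_root_unity_eq[of n p q] n by simp
      with assms False show False by simp
    qed
    with zn sum_eq False show ?thesis
      by (simp add: geometric_sum)
  qed
qed

lemma power2_norm_vec: "norm (x :: complex ^ 'n::finite) ^ 2 = (\<Sum>i\<in>UNIV. cmod (x $ i) ^ 2)"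
  by (simp add: norm_vec_def L2_set_def sum_nonneg)

text \<open>Cauchy-Schwarz against the all-ones vector; \<open>norm\<close> is the Euclidean
  norm.\<close>

lemma l1_norm_le_norm: "l1_norm (x :: complex ^ 'n::finite) \<le> sqrt (real CARD('n)) * norm x"
proof -
  have "l1_norm x = (\<Sum>i\<in>UNIV. \<bar>1\<bar> * \<bar>cmod (x $ i)\<bar>)"
    by (simp add: l1_norm_def)
  also have "\<dots> \<le> L2_set (\<lambda>_. 1) (UNIV :: 'n set) * L2_set (\<lambda>i. cmod (x $ i)) UNIV"
    by (rule L2_set_mult_ineq)
  also have "\<dots> = sqrt (real CARD('n)) * norm x"
    by (simp add: norm_vec_def L2_set_def)
  finally show ?thesis .
qed

lemma norm_le_linf_norm: "norm (x :: complex ^ 'n::finite) \<le> sqrt (real CARD('n)) * linf_norm x"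
proof (rule power2_le_imp_le)
  have "norm x ^ 2 \<le> (\<Sum>i\<in>(UNIV::'n set). linf_norm x ^ 2)"
    unfolding power2_norm_vec by (intro sum_mono power_mono cmod_le_linf_norm) simp
  then show "norm x ^ 2 \<le> (sqrt (real CARD('n)) * linf_norm x) ^ 2"
    by (simp add: power_mult_distrib)
qed (simp add: linf_norm_nonneg)

lemma exists_unimodular_orthogonal_matrix:
  "\<exists>F :: complex ^ 'n ^ 'n::finite.
     (\<forall>i j. cmod (F $ i $ j) = 1) \<and> (\<forall>x. norm (F *v x) = sqrt (real CARD('n)) * norm x)"
proof -
  let ?n = "CARD('n)"
  \<comment> \<open>The index type carries no arithmetic, so its elements are numbered to serve as
    exponents.\<close>
  obtain e :: "'n \<Rightarrow> nat" where e: "bij_betw e UNIV {..<?n}"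
    using ex_bij_betw_finite_nat[of "UNIV :: 'n set"] by (auto simp: atLeast0LessThan)
  then have e_less: "e i < ?n" and e_eq: "e i = e j \<longleftrightarrow> i = j" for i j
    by (auto simp: bij_betw_def inj_on_def)
  define \<omega> where "\<omega> = cis (2 * pi / real ?n)"
  define F :: "complex ^ 'n ^ 'n" where "F = (\<chi> i j. \<omega> ^ (e i * e j))"
  have orth: "(\<Sum>i\<in>UNIV. F $ i $ j * cnj (F $ i $ k)) = (if j = k then of_nat ?n else 0)" for j k
  proof -
    have "(\<Sum>i\<in>UNIV. F $ i $ j * cnj (F $ i $ k))
        = (\<Sum>m<?n. \<omega> ^ (m * e j) * cnj (\<omega> ^ (m * e k)))"
      unfolding F_def vec_lambda_beta by (rule sum.reindex_bij_betw[OF e])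
    then show ?thesis
      using sum_root_of_unity_orthogonal[OF e_less e_less, of j k]
      by (simp only: \<omega>_def e_eq)
  qed
  have isometry: "norm (F *v x) = sqrt (real ?n) * norm x" for x
  proof -
    have "complex_of_real (norm (F *v x) ^ 2)
        = (\<Sum>i\<in>UNIV. \<Sum>j\<in>UNIV. \<Sum>k\<in>UNIV. (F $ i $ j * cnj (F $ i $ k)) * (x $ j * cnj (x $ k)))"
      unfolding power2_norm_vec of_real_sum complex_norm_square
      by (intro sum.cong refl) (simp add: matrix_vector_mult_def sum_product mult_ac)
    \<comment> \<open>Moving the sum over the row index \<open>i\<close> innermost lets column
      orthogonality remove all terms with \<open>j \<noteq> k\<close>.\<close>
    also have "\<dots> = (\<Sum>j\<in>UNIV. \<Sum>k\<in>UNIV. \<Sum>i\<in>UNIV. (F $ i $ j * cnj (F $ i $ k)) * (x $ j * cnj (x $ k)))"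
      by (subst sum.swap) (intro sum.cong refl sum.swap)
    also have "\<dots> = (\<Sum>j\<in>UNIV. \<Sum>k\<in>UNIV. if j = k then of_nat ?n * (x $ j * cnj (x $ k)) else 0)"
      unfolding sum_distrib_right[symmetric] orth by (intro sum.cong refl) simp
    also have "\<dots> = complex_of_real (real ?n * norm x ^ 2)"
      unfolding power2_norm_vec of_real_mult of_real_sum complex_norm_square
      by (simp add: sum_distrib_left)
    finally have "norm (F *v x) ^ 2 = (sqrt (real ?n) * norm x) ^ 2"
      by (simp only: of_real_eq_iff power_mult_distrib) simp
    then show ?thesis
      by (rule power2_eq_imp_eq) simp_all
  qed
  show ?thesis
    using isometry by (intro exI[of _ F]) (simp add: F_def \<omega>_def norm_power)
qed

section \<open>Upper bound and value of the distance\<close>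

theorem mainTheorem2:
  assumes "\<And>a :: 'n::finite \<Rightarrow> complex ^ 'n.
      (\<forall>i. linf_norm (a i) \<le> 1) \<Longrightarrow>
      \<exists>x :: complex ^ 'n. (\<forall>j. cmod (x $ j) = 1) \<and>
        (\<forall>i. cmod (cinner x (a i)) \<le> sqrt (real CARD('n)))"
  shows "banach_mazur_dist (*s) (l1_norm :: complex ^ 'n \<Rightarrow> real)
           (*s) (linf_norm :: complex ^ 'n \<Rightarrow> real) = sqrt (real CARD('n))"
proof -
  obtain F :: "complex ^ 'n ^ 'n" where F: "\<And>i j. cmod (F $ i $ j) = 1"
    "\<And>x. norm (F *v x) = sqrt (real CARD('n)) * norm x"
    using exists_unimodular_orthogonal_matrix by blast
  define A where "A = (*v) F"
  have lin: "Vector_Spaces.linear (*s) (*s) A"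
    unfolding A_def by (rule matrix_vector_mul_linear_gen)
  have "inj A"
  proof (rule injI)
    fix x y assume "A x = A y"
    then show "x = y"
      using F(2)[of "x - y"] by (simp add: A_def matrix_vector_mult_diff_distrib)
  qed
  then have bij: "bij A"
    using vec.linear_inj_imp_surj[OF lin] by (simp add: bij_def)
  have "linf_norm (A x) \<le> 1 * l1_norm x" for x
  proof (rule linf_norm_leI)
    fix i
    have "cmod (A x $ i) \<le> (\<Sum>j\<in>UNIV. cmod (F $ i $ j * x $ j))"
      unfolding A_def matrix_vector_mult_def by (simp add: norm_sum)
    then show "cmod (A x $ i) \<le> 1 * l1_norm x"
      by (simp add: norm_mult F(1) l1_norm_def)
  qed
  then have A_le: "op_norm l1_norm linf_norm A \<le> 1"
    by (rule op_norm_leI) (simp_all add: l1_norm_nonneg)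
  \<comment> \<open>Passing from \<open>l1_norm\<close> to \<open>norm\<close> and from
    \<open>norm\<close> to \<open>linf_norm\<close> costs a factor
    \<open>sqrt (real CARD('n))\<close> each; \<open>inv A\<close> divides the Euclidean norm by the
    same factor, so one remains.\<close>
  have "l1_norm (inv A y) \<le> sqrt (real CARD('n)) * linf_norm y" for y
  proof -
    have "A (inv A y) = y"
      using bij by (simp add: bij_is_surj surj_f_inv_f)
    then have "norm y = sqrt (real CARD('n)) * norm (inv A y)"
      using F(2)[of "inv A y"] by (simp add: A_def)
    then show ?thesis
      using l1_norm_le_norm[of "inv A y"] norm_le_linf_norm[of y] by linarith
  qed
  then have inv_le: "op_norm linf_norm l1_norm (inv A) \<le> sqrt (real CARD('n))"
    by (rule op_norm_leI) (simp_all add: linf_norm_nonneg)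
  \<comment> \<open>Multiplying the two upper bounds requires the norm of \<open>inv A\<close> to be
    nonnegative; the quotient at any vector shows this.\<close>
  have "0 \<le> l1_norm (inv A 0) / linf_norm (0 :: complex ^ 'n)"
    by (simp add: l1_norm_nonneg linf_norm_nonneg)
  also have "\<dots> \<le> op_norm linf_norm l1_norm (inv A)"
    by (rule quotient_le_op_norm_linf_l1[OF linear_inv_vec[OF lin bij]])
  finally have "op_norm l1_norm linf_norm A * op_norm linf_norm l1_norm (inv A) \<le> sqrt (real CARD('n))"
    using mult_mono[OF A_le inv_le] by simp
  then have eq: "sqrt (real CARD('n)) = op_norm l1_norm linf_norm A * op_norm linf_norm l1_norm (inv A)"
    using sqrt_card_le_op_norm_mult[OF assms lin bij] by (intro antisym)
  show ?thesis
    unfolding banach_mazur_dist_def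
  \<comment> \<open>The Fourier map attains the lower bound valid for every \<open>A\<close>, so the
    infimum is a minimum.\<close>
  proof (rule cInf_eq_minimum)
    show "sqrt (real CARD('n)) \<in> {op_norm l1_norm linf_norm A * op_norm linf_norm l1_norm (inv A) |
        A :: complex ^ 'n \<Rightarrow> complex ^ 'n. Vector_Spaces.linear (*s) (*s) A \<and> bij A}"
      using eq lin bij by blast
  qed (use sqrt_card_le_op_norm_mult[OF assms] in blast)
qed

end
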